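(* For every integer $m\ge 2$, the lifting procedure described in the context, run on the set $\mathcal{V}_{m-1}$, correctly produces $\mathcal{V}_m$; that is, the set $X$ it returns equals $\mathcal{V}_m$.
   Context: $[m]=\{1,\dots,m\}$ and $\mathfrak{S}_m$ is the set of all bijections $[m]\to[m]$. For a predicate $P$, $\mathbf{1}(P)=1$ if $P$ is true and $0$ otherwise. $\mathrm{Mod}_m(j)\in\{0,\dots,m-1\}$ is the standard residue of the integer $j$ modulo $m$, and $\overline{\mathrm{Mod}}_m(j)=\mathrm{Mod}_m(j-1)+1\in[m]$. For $m\ge 2$, $$\mathcal{V}_m=\{\theta\in\mathfrak{S}_m:\ \theta(i+1)-\theta(i)\equiv\theta(1)-\mathbf{1}(\theta(m)\le\theta(i)) \pmod m\ \text{ for all } i\in[m-1]\},$$ and $\mathcal{V}_1=\mathfrak{S}_1$. For $m\ge2$ let $\mathfrak{S}_m^1=\{\theta\in\mathfrak{S}_m:\theta(1)=1\}$ and let $\Psi_m:\mathfrak{S}_m^1\to\mathfrak{S}_{m-1}$ be the bijection $\Psi_m(\theta)(i)=\theta(i+1)-1$ for $i\in[m-1]$; its inverse is given by $\Psi_m^{-1}(\pi)(1)=1$ and $\Psi_m^{-1}(\pi)(i)=\pi(i-1)+1$ for $2\le i\le m$. For $a,b\in\mathbb{Z}$ let $\theta_{a,b}(i)=\overline{\mathrm{Mod}}_m(ai+b)$ for $i\in[m]$. For $\theta\in\mathfrak{S}_m$ let $\mathsf{CDS}_m(\theta)=\{\mathrm{Mod}_m(\theta(i+1)-\theta(i)):i\in[m-1]\}$.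 Lifting procedure (for a given $m\ge2$, with input $\mathcal{V}_{m-1}$): 1. Let $X=\emptyset$. 2. For each $\pi\in\mathcal{V}_{m-1}$ do: (a) let $\theta_\pi=\Psi_m^{-1}(\pi)$; (b) if $\mathsf{CDS}_m(\theta_\pi)=\{a\}$ for some $a$, let $Y=\{\theta_{a,0},\theta_{a,1}\}$; (c) if $\mathsf{CDS}_m(\theta_\pi)=\{a,a+1\}$ for some $a$, let $\hat\theta=\overline{\mathrm{Mod}}_m(\theta_\pi(\cdot)+a)$ and let $Y=\{\hat\theta\}$; (d) replace $X$ by $X\cup Y$. 3. Return $X$. *)

theory Defs
  imports "HOL-Number_Theory.Cong" "HOL-Combinatorics.Permutations"
begin

text \<open>
  Indices and values are integers, so that subtraction never truncates. A map from [m] to [m] is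
  represented by a function on all integers that is the identity outside [m] (the convention of
  \<^const>\<open>permutes\<close>); hence equality of such functions is equality of maps on [m].
\<close>

definition perms :: "int \<Rightarrow> (int \<Rightarrow> int) set" where
  "perms m = {\<theta>. \<theta> permutes {1..m}}"

definition Modbar :: "int \<Rightarrow> int \<Rightarrow> int" where
  "Modbar m j = (j - 1) mod m + 1"

definition V :: "int \<Rightarrow> (int \<Rightarrow> int) set" where
  "V m = (if m = 1 then perms 1
     else {\<theta> \<in> perms m. \<forall>i\<in>{1..m - 1}.
             [\<theta> (i + 1) - \<theta> i = \<theta> 1 - of_bool (\<theta> m \<le> \<theta> i)] (mod m)})"

definition perms_one :: "int \<Rightarrow> (int \<Rightarrow> int) set" where
  "perms_one m = {\<theta> \<in> perms m. \<theta> 1 = 1}"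

definition Psi :: "int \<Rightarrow> (int \<Rightarrow> int) \<Rightarrow> int \<Rightarrow> int" where
  "Psi m \<theta> = (\<lambda>i. if i \<in> {1..m - 1} then \<theta> (i + 1) - 1 else i)"

definition Psi_inv :: "int \<Rightarrow> (int \<Rightarrow> int) \<Rightarrow> int \<Rightarrow> int" where
  "Psi_inv m \<pi> = (\<lambda>i. if i = 1 then 1 else if i \<in> {2..m} then \<pi> (i - 1) + 1 else i)"

definition affine :: "int \<Rightarrow> int \<Rightarrow> int \<Rightarrow> int \<Rightarrow> int" where
  "affine m a b = (\<lambda>i. if i \<in> {1..m} then Modbar m (a * i + b) else i)"

definition shift :: "int \<Rightarrow> int \<Rightarrow> (int \<Rightarrow> int) \<Rightarrow> int \<Rightarrow> int" where
  "shift m a \<theta> = (\<lambda>i. if i \<in> {1..m} then Modbar m (\<theta> i + a) else i)"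

definition CDS :: "int \<Rightarrow> (int \<Rightarrow> int) \<Rightarrow> int set" where
  "CDS m \<theta> = {(\<theta> (i + 1) - \<theta> i) mod m | i. i \<in> {1..m - 1}}"

text \<open>
  \<open>lift_step m \<pi> Y\<close>: processing \<open>\<pi>\<close> assigns the set \<open>Y\<close>. No \<open>Y\<close> is
  related to a \<open>\<pi>\<close> to which neither case applies, and then the loop below gets stuck.
\<close>

inductive lift_step :: "int \<Rightarrow> (int \<Rightarrow> int) \<Rightarrow> (int \<Rightarrow> int) set \<Rightarrow> bool" for m where
  single: "CDS m (Psi_inv m \<pi>) = {a} \<Longrightarrow> lift_step m \<pi> {affine m a 0, affine m a 1}"
| double: "CDS m (Psi_inv m \<pi>) = {a, a + 1} \<Longrightarrow> lift_step m \<pi> {shift m a (Psi_inv m \<pi>)}"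

text \<open>
  \<open>lift_loop m R X Z\<close>: with the permutations in \<open>R\<close> still to be processed, in any order, and
  \<open>X\<close> as current value of the accumulator, the loop can terminate and return \<open>Z\<close>.
\<close>

inductive lift_loop ::
    "int \<Rightarrow> (int \<Rightarrow> int) set \<Rightarrow> (int \<Rightarrow> int) set \<Rightarrow> (int \<Rightarrow> int) set \<Rightarrow> bool" for m where
  stop: "lift_loop m {} X X"
| iterate: "\<lbrakk>\<pi> \<in> R; lift_step m \<pi> Y; lift_loop m (R - {\<pi>}) (X \<union> Y) Z\<rbrakk> \<Longrightarrow> lift_loop m R X Z"

definition lifting_returns :: "int \<Rightarrow> (int \<Rightarrow> int) set \<Rightarrow> (int \<Rightarrow> int) set \<Rightarrow> bool" where
  "lifting_returns m S Z \<longleftrightarrow> lift_loop m S {} Z"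

lemma permsI:
  assumes "\<And>i. i \<in> {1..m} \<Longrightarrow> f i \<in> {1..m}" "inj_on f {1..m}" "\<And>i. i \<notin> {1..m} \<Longrightarrow> f i = i"
  shows "f \<in> perms m"
proof -
  have "f ` {1..m} \<subseteq> {1..m}"
    using assms(1) by blast
  then have "bij_betw f {1..m} {1..m}"
    using assms(2) endo_inj_surj[of "{1..m}" f] by (simp add: bij_betw_def)
  then show ?thesis
    unfolding perms_def mem_Collect_eq using assms(3) by (rule bij_imp_permutes)
qed

lemma perms_in: "\<theta> \<in> perms m \<Longrightarrow> i \<in> {1..m} \<Longrightarrow> \<theta> i \<in> {1..m}"
  unfolding perms_def by (metis mem_Collect_eq permutes_in_image)

lemma perms_out: "\<theta> \<in> perms m \<Longrightarrow> i \<notin> {1..m} \<Longrightarrow> \<theta> i = i"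
  by (auto simp: perms_def permutes_def)

lemma perms_eq_iff: "\<theta> \<in> perms m \<Longrightarrow> \<theta> i = \<theta> j \<longleftrightarrow> i = j"
  unfolding perms_def by (metis mem_Collect_eq permutes_inj injD)

lemma Psi_in_perms:
  assumes "m \<ge> 2" "\<theta> \<in> perms_one m"
  shows "Psi m \<theta> \<in> perms (m - 1)"
proof (rule permsI)
  have \<theta>: "\<theta> \<in> perms m" "\<theta> 1 = 1"
    using assms(2) by (auto simp: perms_one_def)
  show "Psi m \<theta> i \<in> {1..m - 1}" if "i \<in> {1..m - 1}" for i
    using that perms_in[OF \<theta>(1), of "i + 1"] perms_eq_iff[OF \<theta>(1), of "i + 1" 1] \<theta>(2)
    by (auto simp: Psi_def)
  show "inj_on (Psi m \<theta>) {1..m - 1}"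
    using perms_eq_iff[OF \<theta>(1)] by (auto simp: inj_on_def Psi_def)
qed (auto simp: Psi_def)

lemma Psi_inv_in_perms_one:
  assumes "m \<ge> 2" "\<pi> \<in> perms (m - 1)"
  shows "Psi_inv m \<pi> \<in> perms_one m"
proof -
  have pos: "1 \<le> \<pi> (i - 1) \<and> \<pi> (i - 1) \<le> m - 1" if "2 \<le> i" "i \<le> m" for i
    using perms_in[OF assms(2), of "i - 1"] that by auto
  have "Psi_inv m \<pi> \<in> perms m"
  proof (rule permsI)
    show "Psi_inv m \<pi> i \<in> {1..m}" if "i \<in> {1..m}" for i
      using that pos[of i] by (auto simp: Psi_inv_def)
    show "inj_on (Psi_inv m \<pi>) {1..m}"
    proof (rule inj_onI)
      fix i j assume "i \<in> {1..m}" "j \<in> {1..m}" "Psi_inv m \<pi> i = Psi_inv m \<pi> j"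
      then show "i = j"
        using pos[of i] pos[of j] perms_eq_iff[OF assms(2), of "i - 1" "j - 1"]
        by (auto simp: Psi_inv_def split: if_splits)
    qed
    show "Psi_inv m \<pi> i = i" if "i \<notin> {1..m}" for i
      using that assms(1) by (auto simp: Psi_inv_def)
  qed
  then show ?thesis
    by (simp add: perms_one_def Psi_inv_def)
qed

lemma Psi_inv_Psi:
  assumes "m \<ge> 2" "\<theta> \<in> perms_one m"
  shows "Psi_inv m (Psi m \<theta>) = \<theta>"
  using assms perms_out[of \<theta> m] by (auto simp: Psi_inv_def Psi_def perms_one_def fun_eq_iff)

lemma Psi_Psi_inv:
  assumes "m \<ge> 2" "\<pi> \<in> perms (m - 1)"
  shows "Psi m (Psi_inv m \<pi>) = \<pi>"
  using assms perms_out[of \<pi> "m - 1"] by (auto simp: Psi_inv_def Psi_def fun_eq_iff)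

lemma bij_betw_Psi: "m \<ge> 2 \<Longrightarrow> bij_betw (Psi m) (perms_one m) (perms (m - 1))"
  by (rule bij_betw_byWitness[where f' = "Psi_inv m"])
     (auto simp: Psi_inv_Psi Psi_Psi_inv Psi_in_perms Psi_inv_in_perms_one)

end

theory Submission
  imports Defs
begin

text \<open>
  Let \<open>\<pi> \<in> V (m - 1)\<close>, \<open>b = \<pi> 1\<close>, \<open>t = \<pi> (m - 1)\<close>, \<open>\<theta> = Psi_inv m \<pi>\<close> and \<open>x = \<theta> i - 1\<close>. A step of
  \<open>\<pi>\<close> adds \<open>b\<close>, or \<open>b - 1\<close> if \<open>t \<le> x\<close>, and then possibly subtracts \<open>m - 1\<close>, which modulo \<open>m\<close> means
  adding 1. So a difference of \<open>\<theta>\<close> is \<open>b - 1\<close> if \<open>t \<le> x \<le> m - b\<close>, \<open>b + 1\<close> if \<open>m - b \<le> x < t\<close>, and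
  \<open>b\<close> otherwise. The two exceptional ranges exclude each other, so one of the two cases of the
  procedure applies, and the range that occurs is exactly what the defining condition of \<open>V m\<close>
  asks of the shifted permutation.

  Conversely, the differences of \<open>\<theta> \<in> V m\<close> are \<open>\<theta> 1\<close> or \<open>\<theta> 1 - 1\<close> modulo \<open>m\<close>. Shifting the first
  value to 1 and applying \<open>Psi m\<close> gives an element of \<open>V (m - 1)\<close>, and the procedure undoes
  the shift, since the \<open>a\<close> it reads off determines \<open>\<theta> 1\<close> (up to 1 in the single case, where
  both candidates are produced).
\<close>

section \<open>Representatives in \<open>{1..m}\<close> and shifted permutations\<close>

lemma Modbar_in: "m \<ge> 1 \<Longrightarrow> Modbar m j \<in> {1..m}"
  by (simp add: Modbar_def add1_zle_eq)

lemma Modbar_cong: "[Modbar m j = j] (mod m)"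
  by (simp add: Modbar_def cong_def mod_add_left_eq)

lemma Modbar_unique:
  assumes "x \<in> {1..m}" "[x = j] (mod m)"
  shows "Modbar m j = x"
proof -
  have "(j - 1) mod m = (x - 1) mod m"
    using assms(2) by (metis cong_def mod_diff_left_eq)
  then show ?thesis
    using assms(1) by (simp add: Modbar_def)
qed

lemma perms_cong_iff:
  assumes "\<theta> \<in> perms m" "i \<in> {1..m}" "j \<in> {1..m}"
  shows "[\<theta> i = \<theta> j] (mod m) \<longleftrightarrow> i = j"
proof
  assume "[\<theta> i = \<theta> j] (mod m)"
  then have "\<theta> i = \<theta> j"
    using Modbar_unique[OF perms_in[OF assms(1,2)], of "\<theta> j"]
      Modbar_unique[OF perms_in[OF assms(1,3)], of "\<theta> j"] by simp
  then show "i = j"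
    using perms_eq_iff[OF assms(1)] by blast
qed simp

lemma shift_cong: "i \<in> {1..m} \<Longrightarrow> [shift m a \<theta> i = \<theta> i + a] (mod m)"
  by (simp add: shift_def Modbar_cong)

lemma shift_eqI:
  assumes "\<theta> \<in> perms m" "\<And>i. i \<in> {1..m} \<Longrightarrow> [\<theta> i = \<rho> i + a] (mod m)"
  shows "shift m a \<rho> = \<theta>"
proof
  fix i
  show "shift m a \<rho> i = \<theta> i"
    using Modbar_unique[OF perms_in[OF assms(1)] assms(2)] perms_out[OF assms(1), of i]
    unfolding shift_def by metis
qed

lemma shift_in_perms:
  assumes "\<theta> \<in> perms m" "m \<ge> 1"
  shows "shift m a \<theta> \<in> perms m"
proof (rule permsI)
  show "inj_on (shift m a \<theta>) {1..m}"
  proof (rule inj_onI)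
    fix i j assume ij: "i \<in> {1..m}" "j \<in> {1..m}" "shift m a \<theta> i = shift m a \<theta> j"
    then have "[\<theta> i + a = \<theta> j + a] (mod m)"
      using shift_cong by (metis cong_sym cong_trans)
    then show "i = j"
      using perms_cong_iff[OF assms(1)] ij by (simp add: cong_add_rcancel)
  qed
qed (use assms(2) Modbar_in in \<open>auto simp only: shift_def if_True if_False\<close>)

section \<open>Membership in \<open>V\<close> and consecutive differences\<close>

text \<open>At \<open>m = 1\<close> the index range is empty, so both clauses of \<open>V\<close>
  take one form; this spares a case split when \<open>m - 1 = 1\<close>.\<close>

lemma V_iff:
  assumes "m \<ge> 1"
  shows "\<theta> \<in> V m \<longleftrightarrow> \<theta> \<in> perms m \<and>
    (\<forall>i\<in>{1..m - 1}. [\<theta> (i + 1) - \<theta> i = \<theta> 1 - of_bool (\<theta> m \<le> \<theta> i)] (mod m))"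
  using assms by (auto simp: V_def)

lemma CDS_iff: "d \<in> CDS m \<theta> \<longleftrightarrow> (\<exists>i\<in>{1..m - 1}. d = (\<theta> (i + 1) - \<theta> i) mod m)"
  by (auto simp: CDS_def)

lemma shift_diff_cong:
  assumes "i \<in> {1..m - 1}"
  shows "[shift m a \<theta> (i + 1) - shift m a \<theta> i = \<theta> (i + 1) - \<theta> i] (mod m)"
  using cong_diff[OF shift_cong[of "i + 1" m a \<theta>] shift_cong[of i m a \<theta>]] assms by simp

lemma CDS_shift: "CDS m (shift m a \<theta>) = CDS m \<theta>"
  using shift_diff_cong[of _ m a \<theta>] unfolding CDS_def cong_def by force

text \<open>Neighbouring values are distinct elements of \<open>{1..m}\<close>, hence distinct
  modulo \<open>m\<close>, so the residue 0 cannot occur.\<close>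

lemma CDS_range:
  assumes "m \<ge> 2" "\<theta> \<in> perms m" "d \<in> CDS m \<theta>"
  shows "1 \<le> d" "d \<le> m - 1"
proof -
  obtain i where i: "i \<in> {1..m - 1}" and d: "d = (\<theta> (i + 1) - \<theta> i) mod m"
    using assms(3) by (auto simp: CDS_iff)
  have "\<not> [\<theta> (i + 1) = \<theta> i] (mod m)"
    using perms_cong_iff[OF assms(2), of "i + 1" i] i by simp
  then have "d \<noteq> 0"
    using d by (simp add: cong_iff_dvd_diff dvd_eq_mod_eq_0)
  moreover have "0 \<le> d" "d < m"
    using d assms(1) by auto
  ultimately show "1 \<le> d" "d \<le> m - 1" by auto
qed

section \<open>A single difference: the affine candidates\<close>

lemma single_cong:
  assumes "CDS m \<theta> = {a}" "\<theta> 1 = 1" "i \<ge> 1" "i \<le> m"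
  shows "[\<theta> i = 1 + (i - 1) * a] (mod m)"
  using assms(3,4)
proof (induction i rule: int_ge_induct)
  case base
  then show ?case using assms(2) by simp
next
  case (step i)
  have "(\<theta> (i + 1) - \<theta> i) mod m = a"
    using assms(1) step by (fastforce simp: CDS_def)
  then have "[\<theta> (i + 1) - \<theta> i = a] (mod m)"
    by (auto simp: cong_def)
  from cong_add[OF this step.IH] show ?case
    using step by (simp add: algebra_simps)
qed

text \<open>With constant difference \<open>a\<close> from the value 1 on, \<open>\<theta> i\<close>
  is \<open>1 + (i - 1) * a\<close> modulo \<open>m\<close>; adding \<open>a - 1 + b\<close> gives
  \<open>a * i + b\<close>. Both cases of the procedure thus produce shifts.\<close>

lemma affine_eq_shift:
  assumes "CDS m \<theta> = {a}" "\<theta> 1 = 1"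
  shows "affine m a b = shift m (a - 1 + b) \<theta>"
proof
  fix i
  have "Modbar m (a * i + b) = Modbar m (\<theta> i + (a - 1 + b))" if "i \<in> {1..m}"
  proof (rule Modbar_unique)
    show "Modbar m (\<theta> i + (a - 1 + b)) \<in> {1..m}"
      using that by (intro Modbar_in) auto
    have "[\<theta> i + (a - 1 + b) = 1 + (i - 1) * a + (a - 1 + b)] (mod m)"
      using single_cong[OF assms] that by (intro cong_add) auto
    also have "1 + (i - 1) * a + (a - 1 + b) = a * i + b"
      by (simp add: algebra_simps)
    finally show "[Modbar m (\<theta> i + (a - 1 + b)) = a * i + b] (mod m)"
      using Modbar_cong cong_trans by blast
  qed
  then show "affine m a b i = shift m (a - 1 + b) \<theta> i"
    by (simp add: affine_def shift_def)
qed

text \<open>The last value is \<open>m\<close>, above all others, so the indicator vanishes, and the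
  first value is the common difference \<open>a\<close>.\<close>

lemma affine_0_in_V:
  assumes "m \<ge> 2" "\<theta> \<in> perms_one m" "CDS m \<theta> = {a}"
  shows "affine m a 0 \<in> V m"
proof -
  have \<theta>: "\<theta> \<in> perms m" "\<theta> 1 = 1"
    using assms(2) by (auto simp: perms_one_def)
  define \<rho> where "\<rho> = affine m a 0"
  have \<rho>: "\<rho> = shift m (a - 1) \<theta>"
    using affine_eq_shift[OF assms(3) \<theta>(2), of 0] by (simp add: \<rho>_def)
  have perm: "\<rho> \<in> perms m"
    unfolding \<rho> using \<theta>(1) assms(1) by (intro shift_in_perms) auto
  have "1 \<le> a" "a \<le> m - 1"
    using CDS_range[OF assms(1) \<theta>(1), of a] assms(3) by auto
  then have one: "\<rho> 1 = a"
    using assms(1) Modbar_unique[of a m a] by (simp add: \<rho>_def affine_def)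
  have last: "\<rho> m = m"
    using assms(1) Modbar_unique[of m m "a * m"] by (simp add: \<rho>_def affine_def cong_def)
  have "[\<rho> (i + 1) - \<rho> i = \<rho> 1 - of_bool (\<rho> m \<le> \<rho> i)] (mod m)" if i: "i \<in> {1..m - 1}" for i
  proof -
    have "(\<rho> (i + 1) - \<rho> i) mod m = a"
      using assms(3) CDS_shift[of m "a - 1" \<theta>] i unfolding \<rho> by (fastforce simp: CDS_def)
    moreover have "\<rho> i < m"
      using perms_in[OF perm, of i] perms_eq_iff[OF perm, of i m] last i by auto
    ultimately show ?thesis
      using last one by (auto simp: cong_def)
  qed
  then show ?thesis
    using V_iff[of m \<rho>] perm assms(1) by (simp add: \<rho>_def)
qed

text \<open>The last value is 1, so the indicator is always 1, and the first value
  \<open>a + 1\<close> compensates for it.\<close>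

lemma affine_1_in_V:
  assumes "m \<ge> 2" "\<theta> \<in> perms_one m" "CDS m \<theta> = {a}"
  shows "affine m a 1 \<in> V m"
proof -
  have \<theta>: "\<theta> \<in> perms m" "\<theta> 1 = 1"
    using assms(2) by (auto simp: perms_one_def)
  define \<rho> where "\<rho> = affine m a 1"
  have \<rho>: "\<rho> = shift m a \<theta>"
    using affine_eq_shift[OF assms(3) \<theta>(2), of 1] by (simp add: \<rho>_def)
  have perm: "\<rho> \<in> perms m"
    unfolding \<rho> using \<theta>(1) assms(1) by (intro shift_in_perms) auto
  have "1 \<le> a" "a \<le> m - 1"
    using CDS_range[OF assms(1) \<theta>(1), of a] assms(3) by auto
  then have one: "\<rho> 1 = a + 1"
    using assms(1) Modbar_unique[of "a + 1" m "a + 1"] by (simp add: \<rho>_def affine_def)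
  have last: "\<rho> m = 1"
    using assms(1) Modbar_unique[of 1 m "a * m + 1"] by (simp add: \<rho>_def affine_def cong_def)
  have "[\<rho> (i + 1) - \<rho> i = \<rho> 1 - of_bool (\<rho> m \<le> \<rho> i)] (mod m)" if i: "i \<in> {1..m - 1}" for i
  proof -
    have "(\<rho> (i + 1) - \<rho> i) mod m = a"
      using assms(3) CDS_shift[of m a \<theta>] i unfolding \<rho> by (fastforce simp: CDS_def)
    moreover have "1 \<le> \<rho> i"
      using perms_in[OF perm, of i] i by auto
    ultimately show ?thesis
      using last one by (auto simp: cong_def)
  qed
  then show ?thesis
    using V_iff[of m \<rho>] perm assms(1) by (simp add: \<rho>_def)
qed

section \<open>Differences of the lifted permutation and membership of its shift\<close>

text \<open>
  Subtracting 1 turns \<open>\<theta>\<close> into the sequence 0, \<open>\<pi> 1\<close>, \<dots>, \<open>\<pi> (m - 1)\<close>, which satisfies the recurrence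
  of \<open>V (m - 1)\<close> also at its new initial value 0.
\<close>

lemma Psi_inv_step:
  assumes "m \<ge> 2" "\<pi> \<in> V (m - 1)" "i \<in> {1..m - 1}"
  defines "x \<equiv> Psi_inv m \<pi> i - 1"
  shows "Psi_inv m \<pi> (i + 1) - 1 = Modbar (m - 1) (x + \<pi> 1 - of_bool (\<pi> (m - 1) \<le> x))"
proof -
  have perm: "\<pi> \<in> perms (m - 1)"
    using assms(1,2) V_iff[of "m - 1" \<pi>] by simp
  have y: "\<pi> i \<in> {1..m - 1}" and t: "\<pi> (m - 1) \<in> {1..m - 1}"
    using perms_in[OF perm, of i] perms_in[OF perm, of "m - 1"] assms(1,3) by auto
  have "[\<pi> i = x + \<pi> 1 - of_bool (\<pi> (m - 1) \<le> x)] (mod m - 1)"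
  proof (cases "i = 1")
    case True
    \<comment> \<open>Here \<open>x = 0\<close> lies below \<open>\<pi> (m - 1)\<close>, so the
      indicator vanishes.\<close>
    then show ?thesis using t by (simp add: x_def Psi_inv_def)
  next
    case False
    then have "x = \<pi> (i - 1)"
      using assms(3) by (simp add: x_def Psi_inv_def)
    moreover have "[\<pi> i - \<pi> (i - 1) = \<pi> 1 - of_bool (\<pi> (m - 1) \<le> \<pi> (i - 1))] (mod m - 1)"
      using assms(1,2,3) False V_iff[of "m - 1" \<pi>] by (force dest: bspec[of _ _ "i - 1"])
    ultimately have "[\<pi> i - x + x = \<pi> 1 - of_bool (\<pi> (m - 1) \<le> x) + x] (mod m - 1)"
      by (intro cong_add) auto
    also have "\<pi> 1 - of_bool (\<pi> (m - 1) \<le> x) + x = x + \<pi> 1 - of_bool (\<pi> (m - 1) \<le> x)"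
      by simp
    finally show ?thesis by simp
  qed
  then show ?thesis
    using Modbar_unique[OF y] assms(3) by (simp add: Psi_inv_def)
qed

lemma Psi_inv_diff_cong:
  assumes "m \<ge> 2" "\<pi> \<in> V (m - 1)" "i \<in> {1..m - 1}"
  defines "x \<equiv> Psi_inv m \<pi> i - 1" and "b \<equiv> \<pi> 1" and "t \<equiv> \<pi> (m - 1)"
  shows "[Psi_inv m \<pi> (i + 1) - Psi_inv m \<pi> i =
    b - of_bool (t \<le> x \<and> x \<le> m - b) + of_bool (m - b \<le> x \<and> x < t)] (mod m)"
proof -
  have perm: "\<pi> \<in> perms (m - 1)"
    using assms(1,2) V_iff[of "m - 1" \<pi>] by simp
  have b: "1 \<le> b" "b \<le> m - 1" and t: "1 \<le> t" "t \<le> m - 1"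
    using perms_in[OF perm, of 1] perms_in[OF perm, of "m - 1"] assms(1) by (auto simp: b_def t_def)
  have x: "0 \<le> x" "x \<le> m - 1"
    using perms_in[of "Psi_inv m \<pi>" m i] Psi_inv_in_perms_one[OF assms(1) perm] assms(3)
    by (auto simp: perms_one_def x_def)
  define s where "s = x + b - of_bool (t \<le> x)"
  \<comment> \<open>A subtracted 1 requires \<open>x \<ge> t \<ge> 1\<close>, which gives the lower
    bound. By the upper bound, reduction subtracts \<open>m - 1\<close> at most once.\<close>
  have s: "1 \<le> s" "s \<le> 2 * (m - 1)"
    using b t x by (auto simp: s_def)
  have step: "Psi_inv m \<pi> (i + 1) - 1 = Modbar (m - 1) s"
    using Psi_inv_step[OF assms(1-3)] by (simp add: s_def x_def b_def t_def)
  have "m - 1 dvd 1 - m"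
    using dvd_minus_iff[of "m - 1" "m - 1"] by simp
  then have "Modbar (m - 1) s = (if s \<le> m - 1 then s else s - (m - 1))"
    using s by (intro Modbar_unique) (auto simp: cong_iff_dvd_diff)
  then have "Psi_inv m \<pi> (i + 1) - Psi_inv m \<pi> i = (if s \<le> m - 1 then s - x else s - x + 1 - m)"
    using step by (auto simp: x_def split: if_splits)
  also have "[\<dots> = (if s \<le> m - 1 then s - x else s - x + 1)] (mod m)"
    by (simp add: cong_iff_dvd_diff)
  \<comment> \<open>The bound \<open>s \<le> m - 1\<close> reads \<open>x \<le> m - b\<close> if
    \<open>t \<le> x\<close>, and \<open>x < m - b\<close> otherwise. For \<open>t \<le> x\<close>
    and \<open>x > m - b\<close> the two corrections cancel.\<close>
  also have "(if s \<le> m - 1 then s - x else s - x + 1) =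
      b - of_bool (t \<le> x \<and> x \<le> m - b) + of_bool (m - b \<le> x \<and> x < t)"
    by (auto simp: s_def)
  finally show ?thesis .
qed

text \<open>The first difference is \<open>b\<close> itself. Comparing \<open>t\<close> with
  \<open>m - b\<close> decides which exceptional range can be nonempty.\<close>

lemma CDS_Psi_inv:
  assumes "m \<ge> 2" "\<pi> \<in> V (m - 1)"
  defines "b \<equiv> \<pi> 1" and "t \<equiv> \<pi> (m - 1)"
  shows "b \<in> CDS m (Psi_inv m \<pi>)"
    and "t \<le> m - b \<Longrightarrow> CDS m (Psi_inv m \<pi>) \<subseteq> {b - 1, b}"
    and "t > m - b \<Longrightarrow> CDS m (Psi_inv m \<pi>) \<subseteq> {b, b + 1}"
proof -
  have perm: "\<pi> \<in> perms (m - 1)"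
    using assms(1,2) V_iff[of "m - 1" \<pi>] by simp
  have b: "1 \<le> b" "b \<le> m - 1"
    using perms_in[OF perm, of 1] assms(1) by (auto simp: b_def)
  have "(Psi_inv m \<pi> (1 + 1) - Psi_inv m \<pi> 1) mod m = b"
    using assms(1) b by (simp add: Psi_inv_def b_def)
  then show "b \<in> CDS m (Psi_inv m \<pi>)"
    using assms(1) unfolding CDS_iff by (intro bexI[of _ 1]) auto
  have \<theta>: "Psi_inv m \<pi> \<in> perms m"
    using Psi_inv_in_perms_one[OF assms(1) perm] by (simp add: perms_one_def)
  \<comment> \<open>The formula for a difference takes values in \<open>{0..m}\<close>. Its ends
    have residue 0, which never occurs, so congruence becomes equality.\<close>
  have eq: "d = D" if "d \<in> CDS m (Psi_inv m \<pi>)" "[d = D] (mod m)" "0 \<le> D" "D \<le> m" for d D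
    using CDS_range[OF assms(1) \<theta> that(1)] that(2-4)
    by (cases "D = m") (auto simp: cong_def)
  have *: "\<exists>x. d = b - of_bool (t \<le> x \<and> x \<le> m - b) + of_bool (m - b \<le> x \<and> x < t)"
    if d: "d \<in> CDS m (Psi_inv m \<pi>)" for d
  proof -
    obtain i where i: "i \<in> {1..m - 1}" "d = (Psi_inv m \<pi> (i + 1) - Psi_inv m \<pi> i) mod m"
      using d by (auto simp: CDS_iff)
    define x where "x = Psi_inv m \<pi> i - 1"
    have "[d = b - of_bool (t \<le> x \<and> x \<le> m - b) + of_bool (m - b \<le> x \<and> x < t)] (mod m)"
      using Psi_inv_diff_cong[OF assms(1,2) i(1)] i(2) by (simp add: b_def t_def x_def cong_def)
    from eq[OF d this] have
      "d = b - of_bool (t \<le> x \<and> x \<le> m - b) + of_bool (m - b \<le> x \<and> x < t)"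
      using b by (auto simp: of_bool_def)
    then show ?thesis ..
  qed
  show "CDS m (Psi_inv m \<pi>) \<subseteq> {b - 1, b}" if "t \<le> m - b"
    using that by (auto dest!: * simp: of_bool_def split: if_splits)
  show "CDS m (Psi_inv m \<pi>) \<subseteq> {b, b + 1}" if "t > m - b"
    using that by (auto dest!: * simp: of_bool_def split: if_splits)
qed

text \<open>The amount \<open>a\<close> is the smaller of the two possible differences, so the first
  value \<open>a + 1\<close> is the larger one. Wrapping around at \<open>m\<close> turns the
  comparison with the last value into the condition that selects the smaller difference.\<close>

lemma shift_Psi_inv_in_V:
  assumes "m \<ge> 2" "\<pi> \<in> V (m - 1)"
  defines "a \<equiv> (if \<pi> (m - 1) \<le> m - \<pi> 1 then \<pi> 1 - 1 else \<pi> 1)"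
  shows "shift m a (Psi_inv m \<pi>) \<in> V m"
proof -
  define b where "b = \<pi> 1"
  define t where "t = \<pi> (m - 1)"
  define \<theta> where "\<theta> = Psi_inv m \<pi>"
  define \<rho> where "\<rho> = shift m a \<theta>"
  have perm: "\<pi> \<in> perms (m - 1)"
    using assms(1,2) V_iff[of "m - 1" \<pi>] by simp
  have b: "1 \<le> b" "b \<le> m - 1" and t: "1 \<le> t" "t \<le> m - 1"
    using perms_in[OF perm, of 1] perms_in[OF perm, of "m - 1"] assms(1) by (auto simp: b_def t_def)
  have a: "a = (if t \<le> m - b then b - 1 else b)"
    by (simp add: a_def b_def t_def)
  have \<theta>: "\<theta> \<in> perms m" "\<theta> 1 = 1" "\<theta> m = t + 1"
    using Psi_inv_in_perms_one[OF assms(1) perm] assms(1)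
    by (auto simp: perms_one_def \<theta>_def t_def Psi_inv_def)
  have val: "\<rho> i = (if \<theta> i + a \<le> m then \<theta> i + a else \<theta> i + a - m)" if "i \<in> {1..m}" for i
  proof -
    have "1 \<le> \<theta> i" "\<theta> i \<le> m"
      using perms_in[OF \<theta>(1) that] by auto
    then have "Modbar m (\<theta> i + a) = (if \<theta> i + a \<le> m then \<theta> i + a else \<theta> i + a - m)"
      using a b by (intro Modbar_unique) (auto simp: cong_iff_dvd_diff)
    then show ?thesis
      using that by (simp add: \<rho>_def shift_def)
  qed
  have one: "\<rho> 1 = a + 1"
    using val[of 1] \<theta>(2) a b assms(1) by auto
  \<comment> \<open>The last value wraps around exactly when \<open>t > m - b\<close>.\<close>
  have last: "\<rho> m = (if t \<le> m - b then t + b else t + 1 + b - m)"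
    using val[of m] \<theta>(3) a b t assms(1) by auto
  have "[\<rho> (i + 1) - \<rho> i = \<rho> 1 - of_bool (\<rho> m \<le> \<rho> i)] (mod m)" if i: "i \<in> {1..m - 1}" for i
  proof -
    define x where "x = \<theta> i - 1"
    have x: "0 \<le> x" "x \<le> m - 1"
      using perms_in[OF \<theta>(1), of i] i by (auto simp: x_def)
    have \<rho>i: "\<rho> i = (if x + 1 + a \<le> m then x + 1 + a else x + 1 + a - m)"
      using val[of i] i by (simp add: x_def)
    have "[\<rho> (i + 1) - \<rho> i = \<theta> (i + 1) - \<theta> i] (mod m)"
      using shift_diff_cong[OF i] by (simp add: \<rho>_def)
    also have "[\<theta> (i + 1) - \<theta> i =
        b - of_bool (t \<le> x \<and> x \<le> m - b) + of_bool (m - b \<le> x \<and> x < t)] (mod m)"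
      using Psi_inv_diff_cong[OF assms(1,2) i] by (simp add: \<theta>_def x_def b_def t_def)
    \<comment> \<open>For \<open>t \<le> m - b\<close> every wrapped value lies below
      \<open>\<rho> m\<close>; otherwise every unwrapped value lies above it. The remaining
      comparisons reduce to \<open>t \<le> x\<close>.\<close>
    also have "b - of_bool (t \<le> x \<and> x \<le> m - b) + of_bool (m - b \<le> x \<and> x < t) =
        \<rho> 1 - of_bool (\<rho> m \<le> \<rho> i)"
      unfolding one last \<rho>i a using b t x by (auto simp: of_bool_def)
    finally show ?thesis .
  qed
  moreover have "\<rho> \<in> perms m"
    unfolding \<rho>_def using \<theta>(1) assms(1) by (intro shift_in_perms) auto
  ultimately show ?thesis
    using V_iff[of m \<rho>] assms(1) by (simp add: \<rho>_def \<theta>_def)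
qed

section \<open>Steps of the procedure: existence, soundness, uniqueness\<close>

lemma lift_step_total:
  assumes "m \<ge> 2" "\<pi> \<in> V (m - 1)"
  shows "\<exists>Y. lift_step m \<pi> Y"
proof -
  let ?C = "CDS m (Psi_inv m \<pi>)" and ?b = "\<pi> 1"
  have "?C \<subseteq> {?b - 1, ?b} \<or> ?C \<subseteq> {?b, ?b + 1}" "?b \<in> ?C"
    using CDS_Psi_inv[OF assms] by linarith+
  then have "?C = {?b} \<or> ?C = {?b - 1, ?b - 1 + 1} \<or> ?C = {?b, ?b + 1}"
    by auto
  then show ?thesis
    using lift_step.intros by metis
qed

lemma lift_step_in_V:
  assumes "m \<ge> 2" "\<pi> \<in> V (m - 1)" "lift_step m \<pi> Y"
  shows "Y \<subseteq> V m"
  using assms(3)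
proof cases
  case (single a)
  have "Psi_inv m \<pi> \<in> perms_one m"
    using assms(1,2) V_iff[of "m - 1" \<pi>] by (intro Psi_inv_in_perms_one) auto
  then show ?thesis
    using single affine_0_in_V affine_1_in_V assms(1) by blast
next
  case (double a)
  \<comment> \<open>A pair \<open>{a, a + 1}\<close> contained in \<open>{b - 1, b}\<close> or
    \<open>{b, b + 1}\<close>, with \<open>b = \<pi> 1\<close>, must be all of it.\<close>
  have "a = (if \<pi> (m - 1) \<le> m - \<pi> 1 then \<pi> 1 - 1 else \<pi> 1)"
    using CDS_Psi_inv[OF assms(1,2)] unfolding double(2) by (auto split: if_splits)
  then show ?thesis
    using double(1) shift_Psi_inv_in_V[OF assms(1,2)] by simp
qed

text \<open>Differences are compared as integers, not as residues, so a set has at most one of the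
  two forms and determines \<open>a\<close>.\<close>

lemma lift_step_unique: "lift_step m \<pi> Y \<Longrightarrow> lift_step m \<pi> Y' \<Longrightarrow> Y = Y'"
  by (elim lift_step.cases) (auto simp: doubleton_eq_iff)

section \<open>Descent from \<open>V m\<close> to \<open>V (m - 1)\<close>\<close>

lemma normalized_in_perms_one:
  assumes "m \<ge> 2" "\<theta> \<in> perms m"
  shows "shift m (1 - \<theta> 1) \<theta> \<in> perms_one m"
  using assms shift_in_perms[of \<theta> m] Modbar_unique[of 1 m 1]
  by (simp add: perms_one_def shift_def)

text \<open>The recurrence of \<open>\<theta>\<close> determines \<open>\<pi> (i + 1)\<close> modulo
  \<open>m\<close>, and the range of \<open>\<pi>\<close> fixes its exact value. Each wraparound
  subtracts \<open>m\<close>, which counts as 1 modulo \<open>m - 1\<close>.\<close>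

lemma Psi_normalized_in_V:
  assumes "m \<ge> 2" "\<theta> \<in> V m"
  shows "Psi m (shift m (1 - \<theta> 1) \<theta>) \<in> V (m - 1)"
proof -
  define c where "c = \<theta> 1"
  define t where "t = \<theta> m"
  define \<pi> where "\<pi> = Psi m (shift m (1 - c) \<theta>)"
  have perm: "\<theta> \<in> perms m"
    and rec: "\<And>i. i \<in> {1..m - 1} \<Longrightarrow> [\<theta> (i + 1) - \<theta> i = c - of_bool (t \<le> \<theta> i)] (mod m)"
    using assms V_iff[of m \<theta>] by (auto simp: c_def t_def)
  have c: "1 \<le> c" "c \<le> m" and t: "1 \<le> t" "t \<le> m" "t \<noteq> c"
    using perms_in[OF perm, of 1] perms_in[OF perm, of m] perms_eq_iff[OF perm, of m 1] assms(1)
    by (auto simp: c_def t_def)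
  have \<pi>_perm: "\<pi> \<in> perms (m - 1)"
    unfolding \<pi>_def c_def using assms(1) perm by (intro Psi_in_perms normalized_in_perms_one)
  have \<theta>_other: "1 \<le> \<theta> (i + 1)" "\<theta> (i + 1) \<le> m" "\<theta> (i + 1) \<noteq> c" if "i \<in> {1..m - 1}" for i
    using perms_in[OF perm, of "i + 1"] perms_eq_iff[OF perm, of "i + 1" 1] that by (auto simp: c_def)
  have val: "\<pi> i = (if c < \<theta> (i + 1) then \<theta> (i + 1) - c else \<theta> (i + 1) - c + m)"
    if i: "i \<in> {1..m - 1}" for i
  proof -
    have "Modbar m (\<theta> (i + 1) + (1 - c)) =
        (if c < \<theta> (i + 1) then \<theta> (i + 1) - c + 1 else \<theta> (i + 1) - c + m + 1)"
      using \<theta>_other[OF i] c by (intro Modbar_unique) (auto simp: cong_iff_dvd_diff)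
    then show ?thesis
      using i by (simp add: \<pi>_def Psi_def shift_def)
  qed
  have small: "x = y" if "[x = y] (mod m)" "1 \<le> x" "x \<le> m" "1 \<le> y" "y \<le> m" for x y
    using Modbar_unique[of x m y] Modbar_unique[of y m y] that by simp
  have \<pi>_cong: "[\<pi> i = \<theta> (i + 1) - c] (mod m)" if "i \<in> {1..m - 1}" for i
    unfolding val[OF that] by (simp add: cong_iff_dvd_diff)
  \<comment> \<open>As \<open>t \<noteq> c\<close>, the indicator of \<open>t \<le> c\<close> is
    that of \<open>t < c\<close>; if it is 1, then \<open>c \<ge> 2\<close>, so the right side stays
    positive.\<close>
  have one: "\<pi> 1 = c - of_bool (t < c)"
  proof (rule small)
    show "[\<pi> 1 = c - of_bool (t < c)] (mod m)"
      using cong_trans[OF \<pi>_cong[of 1] rec[of 1, folded c_def]] assms(1) t by (simp add: c_def order_less_le)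
  qed (use perms_in[OF \<pi>_perm, of 1] assms(1) c t in auto)
  have last: "\<pi> (m - 1) = (if c < t then t - c else t - c + m)"
    using val[of "m - 1"] assms(1) by (simp add: t_def)
  have "[\<pi> (i + 1) - \<pi> i = \<pi> 1 - of_bool (\<pi> (m - 1) \<le> \<pi> i)] (mod m - 1)"
    if i: "i \<in> {1..m - 1 - 1}" for i
  proof -
    define x where "x = \<theta> (i + 1)"
    define s where "s = \<pi> i + c - of_bool (t \<le> x)"
    have x: "1 \<le> x" "x \<le> m" "x \<noteq> c"
      using \<theta>_other[of i] i by (auto simp: x_def)
    have \<pi>i: "\<pi> i = (if c < x then x - c else x - c + m)"
      using val[of i] i by (simp add: x_def)
    have y: "1 \<le> \<pi> (i + 1)" "\<pi> (i + 1) \<le> m - 1"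
      using perms_in[OF \<pi>_perm, of "i + 1"] i by auto
    have "[\<pi> (i + 1) = \<theta> (i + 1 + 1) - c] (mod m)"
      using \<pi>_cong[of "i + 1"] i by simp
    also have "\<theta> (i + 1 + 1) - c = (\<theta> (i + 1 + 1) - x) + (x - c)"
      by simp
    also have "[\<dots> = (c - of_bool (t \<le> x)) + \<pi> i] (mod m)"
      using rec[of "i + 1"] \<pi>_cong[of i] i by (intro cong_add) (auto simp: x_def cong_sym)
    finally have s_cong: "[\<pi> (i + 1) = s] (mod m)"
      by (simp add: s_def algebra_simps)
    \<comment> \<open>The right side is \<open>x - of_bool (t \<le> x)\<close>, an element of
      \<open>{0..m}\<close>. The value 0 would make \<open>m\<close> divide
      \<open>\<pi> (i + 1)\<close>, which lies in \<open>{1..m - 1}\<close>.\<close>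
    have "\<pi> (i + 1) = s - m * of_bool (x < c)"
    proof (cases "s = m * of_bool (x < c)")
      case True
      then have "m dvd \<pi> (i + 1)"
        using s_cong by (simp add: cong_def dvd_eq_mod_eq_0)
      then show ?thesis
        using y zdvd_imp_le by fastforce
    next
      case False
      show ?thesis
      proof (rule small)
        have "[s = s - m * of_bool (x < c)] (mod m)"
          by (simp add: cong_iff_dvd_diff)
        then show "[\<pi> (i + 1) = s - m * of_bool (x < c)] (mod m)"
          using s_cong cong_trans by blast
      qed (use False y c t x in \<open>auto simp: s_def \<pi>i split: if_splits\<close>)
    qed
    then have "\<pi> (i + 1) - \<pi> i =
        c - of_bool (t \<le> x) - of_bool (x < c) - (m - 1) * of_bool (x < c)"
      by (simp add: s_def)
    also have "[\<dots> = c - of_bool (t \<le> x) - of_bool (x < c)] (mod m - 1)"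
      by (simp add: cong_iff_dvd_diff)
    \<comment> \<open>If \<open>t < c\<close>, the two indicators add up to 1, absorbed by
      \<open>\<pi> 1 = c - 1\<close>, plus the indicator of \<open>t \<le> x \<and> x < c\<close>.
      If \<open>c < t\<close>, they exclude each other. Either way what remains is the indicator of
      \<open>\<pi> (m - 1) \<le> \<pi> i\<close>.\<close>
    also have "c - of_bool (t \<le> x) - of_bool (x < c) = \<pi> 1 - of_bool (\<pi> (m - 1) \<le> \<pi> i)"
      unfolding one last \<pi>i using c t x by (auto simp: of_bool_def)
    finally show ?thesis .
  qed
  then show ?thesis
    using V_iff[of "m - 1" \<pi>] \<pi>_perm assms(1) by (simp add: \<pi>_def c_def)
qed

text \<open>Normalizing by the shift \<open>1 - c\<close> keeps all differences, so those read off
  are \<open>c\<close> or \<open>c - 1\<close> modulo \<open>m\<close>; a shift by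
  \<open>c - 1\<close> restores \<open>\<theta>\<close>.\<close>

lemma V_in_lift_step:
  assumes "m \<ge> 2" "\<theta> \<in> V m"
  shows "\<exists>\<pi>\<in>V (m - 1). \<exists>Y. lift_step m \<pi> Y \<and> \<theta> \<in> Y"
proof -
  define c where "c = \<theta> 1"
  define \<rho> where "\<rho> = shift m (1 - c) \<theta>"
  define \<pi> where "\<pi> = Psi m \<rho>"
  have perm: "\<theta> \<in> perms m"
    and rec: "\<And>i. i \<in> {1..m - 1} \<Longrightarrow> [\<theta> (i + 1) - \<theta> i = c - of_bool (\<theta> m \<le> \<theta> i)] (mod m)"
    using assms V_iff[of m \<theta>] by (auto simp: c_def)
  have \<pi>: "\<pi> \<in> V (m - 1)"
    using Psi_normalized_in_V[OF assms] by (simp add: \<pi>_def \<rho>_def c_def)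
  have \<rho>: "\<rho> \<in> perms_one m"
    using normalized_in_perms_one[OF assms(1) perm] by (simp add: \<rho>_def c_def)
  then have inv: "Psi_inv m \<pi> = \<rho>"
    using Psi_inv_Psi[OF assms(1)] by (simp add: \<pi>_def)
  have CDS_cong: "[d = c] (mod m) \<or> [d = c - 1] (mod m)" if d: "d \<in> CDS m \<rho>" for d
  proof -
    obtain i where i: "i \<in> {1..m - 1}" "d = (\<theta> (i + 1) - \<theta> i) mod m"
      using d by (auto simp: \<rho>_def CDS_shift CDS_iff)
    then show ?thesis
      using rec[OF i(1)] by (cases "\<theta> m \<le> \<theta> i") (auto simp: cong_def)
  qed
  have shift_back: "shift m a \<rho> = \<theta>" if "[a = c - 1] (mod m)" for a
  proof (rule shift_eqI[OF perm])
    fix i assume "i \<in> {1..m}"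
    from cong_add[OF shift_cong[OF this, of "1 - c" \<theta>] that] show "[\<theta> i = \<rho> i + a] (mod m)"
      by (simp add: \<rho>_def cong_sym)
  qed
  obtain Y where Y: "lift_step m \<pi> Y"
    using lift_step_total[OF assms(1) \<pi>] by blast
  then have "\<theta> \<in> Y"
  proof cases
    case (single a)
    have "[a = c] (mod m) \<or> [a = c - 1] (mod m)"
      using single CDS_cong inv by simp
    then have "[a - 1 = c - 1] (mod m) \<or> [a = c - 1] (mod m)"
      using cong_diff[OF _ cong_refl] by blast
    then have "shift m (a - 1) \<rho> = \<theta> \<or> shift m a \<rho> = \<theta>"
      using shift_back by blast
    moreover have "affine m a 0 = shift m (a - 1) \<rho>" "affine m a 1 = shift m a \<rho>"
      using affine_eq_shift[of m \<rho> a] single inv \<rho> by (simp_all add: perms_one_def)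
    ultimately show ?thesis
      using single(1) by auto
  next
    case (double a)
    then have in_CDS: "a \<in> CDS m \<rho>" "a + 1 \<in> CDS m \<rho>"
      using inv by auto
    \<comment> \<open>Two distinct differences do not fit into \<open>{1..m - 1}\<close> when
      \<open>m = 2\<close>. This excludes the modulus for which \<open>c\<close> and
      \<open>c - 1\<close> could change roles below.\<close>
    have "m \<noteq> 2"
      using CDS_range(1)[OF assms(1) _ in_CDS(1)] CDS_range(2)[OF assms(1) _ in_CDS(2)] \<rho>
      by (auto simp: perms_one_def)
    have "[a = c - 1] (mod m)"
    proof (rule ccontr)
      assume neg: "\<not> [a = c - 1] (mod m)"
      then have "[a = c] (mod m)"
        using CDS_cong[OF in_CDS(1)] by blast
      moreover have "[a + 1 = c - 1] (mod m)"
        using CDS_cong[OF in_CDS(2)] neg cong_diff[of "a + 1" c m 1 1] by auto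
      ultimately have "[a + 1 - a = c - 1 - c] (mod m)"
        by (intro cong_diff)
      then have "m dvd 2"
        by (simp add: cong_iff_dvd_diff)
      then show False
        using zdvd_imp_le[of m 2] assms(1) \<open>m \<noteq> 2\<close> by simp
    qed
    then show ?thesis
      using shift_back double(1) inv by simp
  qed
  then show ?thesis
    using \<pi> Y by blast
qed

section \<open>The loop and its result\<close>

text \<open>Each \<open>\<pi>\<close> determines its \<open>Y\<close>, so every order of processing
  accumulates the same union. Finiteness lets a run terminate, and the existence of steps keeps it
  from getting stuck.\<close>

lemma lift_loop_iff:
  assumes "finite R" "\<And>\<pi>. \<pi> \<in> R \<Longrightarrow> \<exists>Y. lift_step m \<pi> Y"
  shows "lift_loop m R X Z \<longleftrightarrow> Z = X \<union> \<Union>{Y. \<exists>\<pi>\<in>R. lift_step m \<pi> Y}"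
proof
  show "lift_loop m R X Z \<Longrightarrow> Z = X \<union> \<Union>{Y. \<exists>\<pi>\<in>R. lift_step m \<pi> Y}"
  proof (induction rule: lift_loop.induct)
    case (iterate \<pi> R Y X Z)
    have "{Y. \<exists>\<pi>\<in>R. lift_step m \<pi> Y} = insert Y {Y. \<exists>\<pi>\<in>R - {\<pi>}. lift_step m \<pi> Y}"
      using iterate.hyps(1,2) lift_step_unique by blast
    then show ?case
      using iterate.IH by auto
  qed simp
  have "lift_loop m R X (X \<union> \<Union>{Y. \<exists>\<pi>\<in>R. lift_step m \<pi> Y})"
    using assms
  proof (induction R arbitrary: X rule: finite_induct)
    case empty
    then show ?case by (simp add: lift_loop.stop)
  next
    case (insert \<pi> R)
    obtain Y where Y: "lift_step m \<pi> Y"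
      using insert.prems by blast
    have "{Y. \<exists>\<pi>\<in>insert \<pi> R. lift_step m \<pi> Y} = insert Y {Y. \<exists>\<pi>\<in>R. lift_step m \<pi> Y}"
      using Y lift_step_unique by blast
    moreover have "lift_loop m (insert \<pi> R - {\<pi>}) (X \<union> Y)
        (X \<union> Y \<union> \<Union>{Y. \<exists>\<pi>\<in>R. lift_step m \<pi> Y})"
      using insert.IH[of "X \<union> Y"] insert.prems insert.hyps(2) by simp
    ultimately show ?case
      using lift_loop.iterate[OF _ Y, of "insert \<pi> R"] by (simp add: Un_assoc)
  qed
  then show "Z = X \<union> \<Union>{Y. \<exists>\<pi>\<in>R. lift_step m \<pi> Y} \<Longrightarrow> lift_loop m R X Z"
    by simp
qed

lemma finite_V: "finite (V m)"
proof (rule finite_subset)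
  show "V m \<subseteq> {\<theta>. \<theta> permutes {1..m}}"
    by (auto simp: V_def perms_def)
qed (simp add: finite_permutations)

theorem theorem3:
  fixes m :: int and X :: "(int \<Rightarrow> int) set"
  assumes "m \<ge> 2"
  shows "lifting_returns m (V (m - 1)) X \<longleftrightarrow> X = V m"
proof -
  have "\<Union>{Y. \<exists>\<pi>\<in>V (m - 1). lift_step m \<pi> Y} = V m"
    using lift_step_in_V[OF assms] V_in_lift_step[OF assms] by blast
  then show ?thesis
    by (simp add: lifting_returns_def lift_loop_iff[OF finite_V lift_step_total[OF assms]])
qed

end
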